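(* Let $(X,d)$ be a metric space, let $f_n:X\to X$, $n\ge 0$, be maps, and let $A=(a_{ij})_{N\times N}$ be a transition matrix. The following two statements are equivalent. (a) There exist sequences $\{V_{i,n}\}_{n=0}^{\infty}$, $1\le i\le N$, of nonempty compact subsets of $X$ with $V_{i,n}\cap V_{j,n}=\emptyset$ for all $1\le i\neq j\le N$ and $n\ge 0$, such that every $f_n$, $n\ge0$, is continuous in $E:=\bigcup_{n=0}^{\infty}\bigcup_{i=1}^{N}V_{i,n}$, and $\bigcap_{m=0}^\infty V_\alpha^{m,n}$ is a singleton for every $n\ge0$ and every $\alpha=(a_0,a_1,\dots)\in\Sigma_N^+(A)$, where $V_\alpha^{m,n}:=\bigcap_{k=0}^{m}f_n^{-k}(V_{a_k,n+k})$. (b) For every $n\ge0$ there exists a nonempty compact subset $\Lambda_n\subset X$ with $f_n(\Lambda_n)=\Lambda_{n+1}$, such that every $f_n$, $n\ge 0$, is continuous in $\bigcup_{k=0}^{\infty}\Lambda_k$ and the invariant subsystem of $x_{n+1}=f_n(x_n)$ on $\{\Lambda_n\}_{n=0}^\infty$ is topologically conjugate to $(\Sigma_N^+(A),\sigma_A)$.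
   Context: The maps $f_n$ define the non-autonomous discrete system $x_{n+1}=f_n(x_n)$, $n\ge0$. Notation: $f_i^n:=f_{i+n-1}\circ\cdots\circ f_i$ for $n\ge1$, $f_i^0$ is the identity, and $f_i^{-n}:=(f_i^n)^{-1}$ (preimage). A map is continuous in a set $S\subset X$ if its restriction to $S$ is continuous. A transition matrix is a matrix $A=(a_{ij})_{N\times N}$, $N\ge2$, with $a_{ij}\in\{0,1\}$, $\sum_{j=1}^N a_{ij}\ge1$ for all $i$ and $\sum_{i=1}^N a_{ij}\ge1$ for all $j$. $\Sigma_N^+(A):=\{s=(s_0,s_1,\dots):1\le s_j\le N,\ a_{s_js_{j+1}}=1,\ j\ge0\}$, with metric $\hat\rho(\alpha,\beta):=\sum_{i=0}^\infty \hat d(a_i,b_i)/2^i$ for $\alpha=(a_0,a_1,\dots)$, $\beta=(b_0,b_1,\dots)$, where $\hat d(a,b)=0$ if $a=b$ and $1$ otherwise. The subshift of finite type is $\sigma_A:\Sigma_N^+(A)\to\Sigma_N^+(A)$, $\sigma_A((s_0,s_1,s_2,\dots)):=(s_1,s_2,\dots)$. For subsets $\Lambda_n\subset X$ with $f_n(\Lambda_n)\subset\Lambda_{n+1}$ for all $n\ge0$, the system restricted to $\{\Lambda_n\}$ is called the invariant subsystem on $\{\Lambda_n\}_{n=0}^\infty$. It is topologically conjugate to $(\Sigma_N^+(A),\sigma_A)$ if for every $n\ge0$ there is a continuous bijection $h_n:\Lambda_n\to\Sigma_N^+(A)$ with continuous inverse such that $h_{n+1}\circ f_n=\sigma_A\circ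 h_n$ on $\Lambda_n$. *)

theory Defs
  imports "HOL-Analysis.Analysis"
begin

text \<open>The composition \<open>f\<^sub>i\<^sup>n = f\<^bsub>i+n-1\<^esub> \<circ> \<dots> \<circ> f\<^sub>i\<close> is written \<open>iterate_from f i n\<close>.\<close>

primrec iterate_from :: "(nat \<Rightarrow> 'a \<Rightarrow> 'a) \<Rightarrow> nat \<Rightarrow> nat \<Rightarrow> 'a \<Rightarrow> 'a" where
  "iterate_from f i 0 = id"
| "iterate_from f i (Suc n) = f (i + n) \<circ> iterate_from f i n"

text \<open>An \<open>N \<times> N\<close> matrix is a function on indices of which only the values at
  \<open>1 \<le> i, j \<le> N\<close> matter.\<close>

definition transition_matrix :: "nat \<Rightarrow> (nat \<Rightarrow> nat \<Rightarrow> nat) \<Rightarrow> bool" where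
  "transition_matrix N A \<longleftrightarrow>
     2 \<le> N \<and>
     (\<forall>i\<in>{1..N}. \<forall>j\<in>{1..N}. A i j \<in> {0, 1}) \<and>
     (\<forall>i\<in>{1..N}. 1 \<le> (\<Sum>j=1..N. A i j)) \<and>
     (\<forall>j\<in>{1..N}. 1 \<le> (\<Sum>i=1..N. A i j))"

definition shift_space :: "nat \<Rightarrow> (nat \<Rightarrow> nat \<Rightarrow> nat) \<Rightarrow> (nat \<Rightarrow> nat) set" where
  "shift_space N A = {s. \<forall>j. 1 \<le> s j \<and> s j \<le> N \<and> A (s j) (s (Suc j)) = 1}"

definition symbol_dist :: "nat \<Rightarrow> nat \<Rightarrow> real" where
  "symbol_dist a b = (if a = b then 0 else 1)"

definition shift_dist :: "(nat \<Rightarrow> nat) \<Rightarrow> (nat \<Rightarrow> nat) \<Rightarrow> real" where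
  "shift_dist \<alpha> \<beta> = (\<Sum>i. symbol_dist (\<alpha> i) (\<beta> i) / 2 ^ i)"

definition shift_map :: "(nat \<Rightarrow> nat) \<Rightarrow> nat \<Rightarrow> nat" where
  "shift_map s = (\<lambda>j. s (Suc j))"

lemma shift_map_in_shift_space: "s \<in> shift_space N A \<Longrightarrow> shift_map s \<in> shift_space N A"
  by (simp add: shift_space_def shift_map_def)

lemma summable_shift_dist: "summable (\<lambda>i. symbol_dist (\<alpha> i) (\<beta> i) / 2 ^ i)"
proof (rule summable_comparison_test')
  show "summable (\<lambda>i. (1 / 2) ^ i :: real)"
    by (simp add: summable_geometric)
  show "norm (symbol_dist (\<alpha> i) (\<beta> i) / 2 ^ i) \<le> (1 / 2) ^ i" if "0 \<le> i" for i
    by (simp add: symbol_dist_def power_one_over)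
qed

text \<open>\<open>Metric_space.mtopology\<close> is a total function of its arguments; the following shows
  that it is applied below to a genuine metric.\<close>

lemma Metric_space_shift_space: "Metric_space (shift_space N A) shift_dist"
proof
  show "0 \<le> shift_dist x y" for x y
    unfolding shift_dist_def
    by (rule suminf_nonneg[OF summable_shift_dist]) (simp add: symbol_dist_def)
  show "shift_dist x y = shift_dist y x" for x y
    by (simp add: shift_dist_def symbol_dist_def eq_commute)
  show "shift_dist x y = 0 \<longleftrightarrow> x = y" for x y
    unfolding shift_dist_def
    by (subst suminf_eq_zero_iff[OF summable_shift_dist])
       (auto simp: symbol_dist_def fun_eq_iff)
  show "shift_dist x z \<le> shift_dist x y + shift_dist y z" for x y z
    unfolding shift_dist_def
    by (subst suminf_add[OF summable_shift_dist summable_shift_dist],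
        rule suminf_le[OF _ summable_shift_dist summable_add[OF summable_shift_dist summable_shift_dist]])
       (auto simp: symbol_dist_def)
qed

abbreviation shift_topology :: "nat \<Rightarrow> (nat \<Rightarrow> nat \<Rightarrow> nat) \<Rightarrow> (nat \<Rightarrow> nat) topology" where
  "shift_topology N A \<equiv> Metric_space.mtopology (shift_space N A) shift_dist"

definition invariant_subsystem ::
    "(nat \<Rightarrow> 'a \<Rightarrow> 'a) \<Rightarrow> (nat \<Rightarrow> 'a set) \<Rightarrow> bool" where
  "invariant_subsystem f \<Lambda> \<longleftrightarrow> (\<forall>n. f n ` \<Lambda> n \<subseteq> \<Lambda> (Suc n))"

definition conjugate_to_shift ::
    "(nat \<Rightarrow> 'a::metric_space \<Rightarrow> 'a) \<Rightarrow> (nat \<Rightarrow> 'a set) \<Rightarrow> nat \<Rightarrow> (nat \<Rightarrow> nat \<Rightarrow> nat) \<Rightarrow> bool" where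
  "conjugate_to_shift f \<Lambda> N A \<longleftrightarrow>
     invariant_subsystem f \<Lambda> \<and>
     (\<exists>h. \<forall>n.
        bij_betw (h n) (\<Lambda> n) (shift_space N A) \<and>
        continuous_map (top_of_set (\<Lambda> n)) (shift_topology N A) (h n) \<and>
        continuous_map (shift_topology N A) (top_of_set (\<Lambda> n)) (inv_into (\<Lambda> n) (h n)) \<and>
        (\<forall>x\<in>\<Lambda> n. h (Suc n) (f n x) = shift_map (h n x)))"

definition itinerary_set ::
    "(nat \<Rightarrow> 'a \<Rightarrow> 'a) \<Rightarrow> (nat \<Rightarrow> nat \<Rightarrow> 'a set) \<Rightarrow> (nat \<Rightarrow> nat) \<Rightarrow> nat \<Rightarrow> nat \<Rightarrow> 'a set" where
  "itinerary_set f V \<alpha> m n = (\<Inter>k\<in>{0..m}. iterate_from f n k -` V (\<alpha> k) (n + k))"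

end

theory Submission
  imports Defs
begin

text \<open>Given the sets \<open>V\<close>, let \<open>\<Lambda>\<^sub>n\<close> consist of the points whose itinerary from time \<open>n\<close> is an element
  of the shift space. By disjointness, \<open>\<Lambda>\<^sub>n\<close> is also the intersection over \<open>m\<close> of the unions of all
  itinerary sets of length \<open>m\<close>; for fixed \<open>m\<close> only finitely many such sets occur, and each is
  compact, so \<open>\<Lambda>\<^sub>n\<close> is compact and reading off the itinerary is locally constant in each symbol. The
  itinerary map is therefore a continuous bijection from a compact space onto a Hausdorff space.
  Conversely, a conjugacy \<open>h\<close> yields \<open>V\<close> by splitting \<open>\<Lambda>\<^sub>n\<close> according to the first symbol of \<open>h\<^sub>n\<close>.\<close>

section \<open>Iterates and their codes\<close>

text \<open>The recursion of \<open>iterate_from\<close> splits off the last map; splitting off the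
  first one matches the shift, which drops the first symbol.\<close>

lemma iterate_from_Suc_left: "iterate_from f n (Suc k) x = iterate_from f (Suc n) k (f n x)"
  by (induction k) auto

lemma iterate_from_in_forward_invariant:
  assumes "\<And>n. f n ` \<Lambda> n \<subseteq> \<Lambda> (Suc n)" "x \<in> \<Lambda> n"
  shows "iterate_from f n k x \<in> \<Lambda> (n + k)"
  using assms by (induction k) auto

text \<open>A conjugacy turns k steps of the system into k shifts. The offset \<open>j\<close> stays
  general because the induction step uses it at \<open>Suc j\<close>; with \<open>j = 0\<close> the
  code of x records its itinerary.\<close>

lemma coding_iterate_from:
  assumes "\<And>n. f n ` \<Lambda> n \<subseteq> \<Lambda> (Suc n)"
    and "\<And>n x. x \<in> \<Lambda> n \<Longrightarrow> h (Suc n) (f n x) = shift_map (h n x)"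
    and "x \<in> \<Lambda> n"
  shows "h (n + k) (iterate_from f n k x) j = h n x (k + j)"
proof (induction k arbitrary: j)
  case (Suc k)
  have "iterate_from f n k x \<in> \<Lambda> (n + k)"
    using iterate_from_in_forward_invariant[of f \<Lambda>] assms by blast
  then show ?case
    using assms(2)[of "iterate_from f n k x" "n + k"] Suc by (simp add: shift_map_def)
qed simp

section \<open>Transition matrices and admissible words\<close>

lemma transition_matrix_successor:
  assumes "transition_matrix N A" "i \<in> {1..N}"
  shows "\<exists>j\<in>{1..N}. A i j = 1"
proof -
  have "(\<Sum>j=1..N. A i j) \<noteq> 0"
    using assms unfolding transition_matrix_def by fastforce
  then obtain j where "j \<in> {1..N}" "A i j \<noteq> 0"
    by (meson sum.neutral)
  moreover have "A i j \<in> {0, 1}"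
    using assms \<open>j \<in> {1..N}\<close> unfolding transition_matrix_def by blast
  ultimately show ?thesis using \<open>j \<in> {1..N}\<close> by auto
qed

lemma transition_matrix_predecessor:
  assumes "transition_matrix N A" "j \<in> {1..N}"
  shows "\<exists>i\<in>{1..N}. A i j = 1"
proof -
  have "(\<Sum>i=1..N. A i j) \<noteq> 0"
    using assms unfolding transition_matrix_def by fastforce
  then obtain i where "i \<in> {1..N}" "A i j \<noteq> 0"
    by (meson sum.neutral)
  moreover have "A i j \<in> {0, 1}"
    using assms \<open>i \<in> {1..N}\<close> unfolding transition_matrix_def by blast
  ultimately show ?thesis using \<open>i \<in> {1..N}\<close> by auto
qed

lemma shift_space_range: "s \<in> shift_space N A \<Longrightarrow> s k \<in> {1..N}"
  by (simp add: shift_space_def)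

text \<open>Every row of \<open>A\<close> contains a 1, so a successor function \<open>g\<close> can
  be chosen, and iterating it from \<open>i\<close> produces an admissible word.\<close>

lemma shift_space_start:
  assumes "transition_matrix N A" "i \<in> {1..N}"
  shows "\<exists>s\<in>shift_space N A. s 0 = i"
proof -
  have "\<forall>i\<in>{1..N}. \<exists>j. j \<in> {1..N} \<and> A i j = 1"
    using transition_matrix_successor[OF assms(1)] by blast
  from bchoice[OF this] obtain g
    where g: "\<And>i. i \<in> {1..N} \<Longrightarrow> g i \<in> {1..N} \<and> A i (g i) = 1"
    by blast
  define s where "s k = (g ^^ k) i" for k
  have "s k \<in> {1..N}" for k
    by (induction k) (use assms(2) g in \<open>simp_all add: s_def\<close>)
  then have "s \<in> shift_space N A"
    using g by (auto simp: shift_space_def s_def)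
  moreover have "s 0 = i" by (simp add: s_def)
  ultimately show ?thesis by blast
qed

text \<open>Every column of \<open>A\<close> contains a 1, so each admissible word extends to the
  left. This gives equality rather than inclusion in \<open>map_coded_set\<close>.\<close>

lemma shift_map_image_shift_space:
  assumes "transition_matrix N A"
  shows "shift_map ` shift_space N A = shift_space N A"
proof (intro equalityI subsetI)
  fix s assume s: "s \<in> shift_space N A"
  obtain i where i: "i \<in> {1..N}" "A i (s 0) = 1"
    using transition_matrix_predecessor[OF assms shift_space_range[OF s]] by blast
  have "case_nat i s \<in> shift_space N A"
    using i s by (auto simp: shift_space_def split: nat.split)
  moreover have "s = shift_map (case_nat i s)"
    by (simp add: shift_map_def)
  ultimately show "s \<in> shift_map ` shift_space N A" by blast
qed (use shift_map_in_shift_space in blast)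

section \<open>Metric and topology of the shift space\<close>

text \<open>A disagreement at place \<open>k\<close> alone contributes \<open>1 / 2 ^ k\<close> to a
  series of nonnegative terms.\<close>

lemma shift_dist_less_imp_eq:
  assumes "shift_dist \<alpha> \<beta> < 1 / 2 ^ k"
  shows "\<alpha> k = \<beta> k"
proof (rule ccontr)
  assume "\<alpha> k \<noteq> \<beta> k"
  then have "1 / 2 ^ k = (\<Sum>i\<in>{k}. symbol_dist (\<alpha> i) (\<beta> i) / 2 ^ i)"
    by (simp add: symbol_dist_def)
  also have "\<dots> \<le> shift_dist \<alpha> \<beta>"
    unfolding shift_dist_def
    by (rule sum_le_suminf[OF summable_shift_dist]) (auto simp: symbol_dist_def)
  finally show False using assms by simp
qed

text \<open>Only terms beyond place \<open>m\<close> survive, and they are dominated by a geometric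
  tail with sum \<open>1 / 2 ^ m\<close>.\<close>

lemma shift_dist_le:
  assumes "\<And>k. k \<le> m \<Longrightarrow> \<alpha> k = \<beta> k"
  shows "shift_dist \<alpha> \<beta> \<le> 1 / 2 ^ m"
proof -
  let ?t = "\<lambda>i. symbol_dist (\<alpha> i) (\<beta> i) / 2 ^ i"
  have "shift_dist \<alpha> \<beta> = (\<Sum>i. ?t (i + Suc m)) + (\<Sum>i<Suc m. ?t i)"
    unfolding shift_dist_def by (rule suminf_split_initial_segment[OF summable_shift_dist])
  also have "(\<Sum>i<Suc m. ?t i) = 0"
    using assms by (intro sum.neutral) (auto simp: symbol_dist_def)
  also have "(\<Sum>i. ?t (i + Suc m)) \<le> (\<Sum>i. (1 / 2 ^ Suc m) * (1 / 2) ^ i)"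
  proof (rule suminf_le)
    show "?t (i + Suc m) \<le> (1 / 2 ^ Suc m) * (1 / 2) ^ i" for i
      by (simp add: symbol_dist_def power_add power_one_over mult.commute)
    show "summable (\<lambda>i. ?t (i + Suc m))"
      by (rule summable_ignore_initial_segment[OF summable_shift_dist])
    show "summable (\<lambda>i. (1 / 2 ^ Suc m) * (1 / 2 :: real) ^ i)"
      by (intro summable_mult summable_geometric) simp
  qed
  also have "\<dots> = 1 / 2 ^ m"
    by (subst suminf_mult) (simp_all add: suminf_geometric summable_geometric)
  finally show ?thesis by simp
qed

lemma topspace_shift_topology: "topspace (shift_topology N A) = shift_space N A"
  by (rule Metric_space.topspace_mtopology[OF Metric_space_shift_space])

text \<open>The ball of radius \<open>1 / 2 ^ k\<close> about a word fixes its symbol at place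
  \<open>k\<close>. As \<open>P\<close> is arbitrary, complements have the same form, whence
  closedness below.\<close>

lemma openin_shift_topology_symbol:
  "openin (shift_topology N A) {s \<in> shift_space N A. P (s k)}"
proof -
  have "\<exists>r>0. Metric_space.mball (shift_space N A) shift_dist s r \<subseteq> {s \<in> shift_space N A. P (s k)}"
    if "P (s k)" for s
    using that shift_dist_less_imp_eq[of s _ k]
    by (intro exI[of _ "1 / 2 ^ k"])
       (auto simp: Metric_space.in_mball[OF Metric_space_shift_space])
  then show ?thesis
    unfolding Metric_space.openin_mtopology[OF Metric_space_shift_space] by blast
qed

lemma closedin_shift_topology_symbol:
  "closedin (shift_topology N A) {s \<in> shift_space N A. P (s k)}"
proof -
  have "shift_space N A - {s \<in> shift_space N A. P (s k)} = {s \<in> shift_space N A. \<not> P (s k)}"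
    by blast
  then show ?thesis
    using openin_shift_topology_symbol[of N A "\<lambda>i. \<not> P i" k]
    by (auto simp: closedin_def topspace_shift_topology)
qed

text \<open>Words that agree up to place \<open>m\<close> are within \<open>1 / 2 ^ m\<close>, so
  local constancy of every finite prefix suffices.\<close>

lemma continuous_map_shift_topology:
  assumes "\<And>x. x \<in> topspace X \<Longrightarrow> h x \<in> shift_space N A"
    and "\<And>x m. x \<in> topspace X \<Longrightarrow> \<exists>U. openin X U \<and> x \<in> U \<and> (\<forall>y\<in>U. \<forall>k\<le>m. h y k = h x k)"
  shows "continuous_map X (shift_topology N A) h"
  unfolding Metric_space.continuous_map_to_metric[OF Metric_space_shift_space]
proof (intro ballI allI impI)
  fix x and \<epsilon> :: real
  assume x: "x \<in> topspace X" and "0 < \<epsilon>"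
  then obtain m where m: "1 / 2 ^ m < \<epsilon>"
    using real_arch_pow_inv[of \<epsilon> "1 / 2"] by (auto simp: power_one_over)
  obtain U where U: "openin X U" "x \<in> U" "\<And>y k. y \<in> U \<Longrightarrow> k \<le> m \<Longrightarrow> h y k = h x k"
    using assms(2)[OF x, of m] by blast
  have "h y \<in> Metric_space.mball (shift_space N A) shift_dist (h x) \<epsilon>" if "y \<in> U" for y
  proof -
    have "shift_dist (h x) (h y) \<le> 1 / 2 ^ m"
      by (rule shift_dist_le) (rule U(3)[OF that, symmetric])
    then show ?thesis
      using m assms(1) x U(1) that openin_subset[of X U]
      by (auto simp: Metric_space.in_mball[OF Metric_space_shift_space])
  qed
  with U show "\<exists>U. openin X U \<and> x \<in> U \<and>
      (\<forall>y\<in>U. h y \<in> Metric_space.mball (shift_space N A) shift_dist (h x) \<epsilon>)"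
    by blast
qed

section \<open>Itinerary sets: recursion, compactness, finiteness\<close>

lemma mem_itinerary_set:
  "x \<in> itinerary_set f V \<alpha> m n \<longleftrightarrow> (\<forall>k\<le>m. iterate_from f n k x \<in> V (\<alpha> k) (n + k))"
  by (auto simp: itinerary_set_def)

lemma mem_Inter_itinerary_set:
  "x \<in> (\<Inter>m. itinerary_set f V \<alpha> m n) \<longleftrightarrow> (\<forall>k. iterate_from f n k x \<in> V (\<alpha> k) (n + k))"
  by (auto simp: mem_itinerary_set)

text \<open>This recursion involves a preimage under the single map \<open>f n\<close>, so that
  continuity of the iterates never has to be discussed.\<close>

lemma itinerary_set_Suc:
  "itinerary_set f V \<alpha> (Suc m) n = V (\<alpha> 0) n \<inter> f n -` itinerary_set f V (shift_map \<alpha>) m (Suc n)"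
proof (rule set_eqI)
  fix x
  let ?P = "\<lambda>k. iterate_from f n k x \<in> V (\<alpha> k) (n + k)"
  have "x \<in> itinerary_set f V \<alpha> (Suc m) n \<longleftrightarrow> ?P 0 \<and> (\<forall>k\<le>m. ?P (Suc k))"
    using All_less_Suc2[of "Suc m" ?P] by (simp only: mem_itinerary_set less_Suc_eq_le)
  then show "x \<in> itinerary_set f V \<alpha> (Suc m) n \<longleftrightarrow>
      x \<in> V (\<alpha> 0) n \<inter> f n -` itinerary_set f V (shift_map \<alpha>) m (Suc n)"
    by (simp add: mem_itinerary_set[where n = "Suc n"] shift_map_def iterate_from_Suc_left
        del: iterate_from.simps(2))
qed

text \<open>Since \<open>f n\<close> is continuous only on the sets \<open>V i n\<close>, preimages
  are taken relative to the compact set \<open>V (\<alpha> 0) n\<close>. The induction varies word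
  and time, because the recursion passes to the shifted word at time \<open>Suc n\<close>.\<close>

lemma compact_itinerary_set:
  fixes f :: "nat \<Rightarrow> 'a::metric_space \<Rightarrow> 'a"
  assumes "\<And>n i. i \<in> I \<Longrightarrow> compact (V i n)"
    and "\<And>n i. i \<in> I \<Longrightarrow> continuous_on (V i n) (f n)"
    and "\<And>k. \<alpha> k \<in> I"
  shows "compact (itinerary_set f V \<alpha> m n)"
  using assms(3)
proof (induction m arbitrary: \<alpha> n)
  case 0
  then show ?case
    using assms(1) by (simp add: itinerary_set_def)
next
  case (Suc m)
  have "closed (V (\<alpha> 0) n \<inter> f n -` itinerary_set f V (shift_map \<alpha>) m (Suc n))"
    using Suc assms(1,2)
    by (intro continuous_closed_preimage compact_imp_closed) (auto simp: shift_map_def)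
  then have "compact (V (\<alpha> 0) n \<inter> (V (\<alpha> 0) n \<inter> f n -` itinerary_set f V (shift_map \<alpha>) m (Suc n)))"
    using Suc assms(1) by (intro compact_Int_closed) auto
  then show ?case
    by (simp add: itinerary_set_Suc Int_assoc[symmetric])
qed

lemma finite_itinerary_sets:
  assumes "\<And>\<alpha> k. \<alpha> \<in> S \<Longrightarrow> \<alpha> k \<in> I" "finite I"
  shows "finite ((\<lambda>\<alpha>. itinerary_set f V \<alpha> m n) ` S)"
proof -
  \<comment> \<open>Only the symbols up to \<open>m\<close> matter. Setting the others to
    \<open>undefined\<close> by \<open>restrict\<close> places the words in a finite extensional
    function space.\<close>
  have "itinerary_set f V \<alpha> m n = itinerary_set f V (restrict \<alpha> {..m}) m n" for \<alpha>
    by (auto simp: mem_itinerary_set)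
  then have "(\<lambda>\<alpha>. itinerary_set f V \<alpha> m n) ` S =
      (\<lambda>\<alpha>. itinerary_set f V \<alpha> m n) ` (\<lambda>\<alpha>. restrict \<alpha> {..m}) ` S"
    unfolding image_image by (rule image_cong[OF refl])
  moreover have "(\<lambda>\<alpha>. restrict \<alpha> {..m}) ` S \<subseteq> {..m} \<rightarrow>\<^sub>E I"
    using assms(1) by (auto split: if_splits)
  then have "finite ((\<lambda>\<alpha>. restrict \<alpha> {..m}) ` S)"
    by (rule finite_subset) (simp add: finite_PiE assms(2))
  ultimately show ?thesis by simp
qed

section \<open>From the sets V to a conjugacy\<close>

locale coded_system =
  fixes f :: "nat \<Rightarrow> 'a::metric_space \<Rightarrow> 'a"
    and V :: "nat \<Rightarrow> nat \<Rightarrow> 'a set"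
    and N :: nat
    and A :: "nat \<Rightarrow> nat \<Rightarrow> nat"
  assumes matrix: "transition_matrix N A"
    and compact_V: "i \<in> {1..N} \<Longrightarrow> compact (V i n)"
    and disjoint_V: "i \<in> {1..N} \<Longrightarrow> j \<in> {1..N} \<Longrightarrow> x \<in> V i n \<Longrightarrow> x \<in> V j n \<Longrightarrow> i = j"
    and continuous_V: "i \<in> {1..N} \<Longrightarrow> continuous_on (V i n) (f n)"
    and singleton: "\<alpha> \<in> shift_space N A \<Longrightarrow> is_singleton (\<Inter>m. itinerary_set f V \<alpha> m n)"
begin

definition point :: "nat \<Rightarrow> (nat \<Rightarrow> nat) \<Rightarrow> 'a" where
  "point n \<alpha> = the_elem (\<Inter>m. itinerary_set f V \<alpha> m n)"

definition coded_set :: "nat \<Rightarrow> 'a set" where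
  "coded_set n = point n ` shift_space N A"

text \<open>The itinerary map is taken as the inverse of \<open>point\<close>, so that its
  bijectivity reduces to injectivity of \<open>point\<close>.\<close>

definition code :: "nat \<Rightarrow> 'a \<Rightarrow> nat \<Rightarrow> nat" where
  "code n = inv_into (shift_space N A) (point n)"

text \<open>The singleton assumption in working form: a point is identified by checking the sets
  that its orbit visits.\<close>

lemma eq_point_iff:
  assumes "\<alpha> \<in> shift_space N A"
  shows "x = point n \<alpha> \<longleftrightarrow> (\<forall>k. iterate_from f n k x \<in> V (\<alpha> k) (n + k))"
proof -
  have "(\<Inter>m. itinerary_set f V \<alpha> m n) = {point n \<alpha>}"
    using singleton[OF assms] unfolding point_def is_singleton_the_elem .
  then show ?thesis
    using mem_Inter_itinerary_set[of x f V \<alpha> n] by auto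
qed

lemma iterate_point:
  "\<alpha> \<in> shift_space N A \<Longrightarrow> iterate_from f n k (point n \<alpha>) \<in> V (\<alpha> k) (n + k)"
  using eq_point_iff by blast

lemma symbol_unique:
  assumes "\<alpha> \<in> shift_space N A" "\<beta> \<in> shift_space N A"
    and "iterate_from f n k x \<in> V (\<alpha> k) (n + k)" "iterate_from f n k x \<in> V (\<beta> k) (n + k)"
  shows "\<alpha> k = \<beta> k"
  by (rule disjoint_V[OF shift_space_range[OF assms(1)] shift_space_range[OF assms(2)] assms(3,4)])

text \<open>At each time the orbit lies in at most one of the disjoint sets, so the point determines
  every symbol.\<close>

lemma inj_on_point: "inj_on (point n) (shift_space N A)"
proof (rule inj_onI)
  fix \<alpha> \<beta> assume "\<alpha> \<in> shift_space N A" "\<beta> \<in> shift_space N A" "point n \<alpha> = point n \<beta>"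
  then have "\<alpha> k = \<beta> k" for k
    using symbol_unique[of \<alpha> \<beta> n k "point n \<alpha>"] iterate_point[of _ n k] by metis
  then show "\<alpha> = \<beta>" by blast
qed

lemma code_point: "\<alpha> \<in> shift_space N A \<Longrightarrow> code n (point n \<alpha>) = \<alpha>"
  unfolding code_def by (rule inv_into_f_f[OF inj_on_point])

lemma bij_betw_code: "bij_betw (code n) (coded_set n) (shift_space N A)"
  unfolding code_def coded_set_def
  by (intro bij_betw_inv_into inj_on_imp_bij_betw inj_on_point)

lemma map_point:
  assumes "\<alpha> \<in> shift_space N A"
  shows "f n (point n \<alpha>) = point (Suc n) (shift_map \<alpha>)"
  unfolding eq_point_iff[OF shift_map_in_shift_space[OF assms]]
proof
  fix k
  show "iterate_from f (Suc n) k (f n (point n \<alpha>)) \<in> V (shift_map \<alpha> k) (Suc n + k)"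
    using iterate_point[OF assms, of n "Suc k"]
    by (simp add: iterate_from_Suc_left shift_map_def del: iterate_from.simps(2))
qed

lemma map_coded_set: "f n ` coded_set n = coded_set (Suc n)"
proof -
  have "f n ` coded_set n = point (Suc n) ` shift_map ` shift_space N A"
    unfolding coded_set_def image_image using map_point by simp
  also have "\<dots> = coded_set (Suc n)"
    by (simp add: shift_map_image_shift_space[OF matrix] coded_set_def)
  finally show ?thesis .
qed

lemma code_map: "x \<in> coded_set n \<Longrightarrow> code (Suc n) (f n x) = shift_map (code n x)"
  by (auto simp: coded_set_def map_point code_point shift_map_in_shift_space)

text \<open>Transfers continuity from the union of the sets \<open>V i k\<close> to the union of the
  coded sets.\<close>

lemma coded_set_subset: "coded_set n \<subseteq> (\<Union>i\<in>{1..N}. V i n)"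
  using iterate_point[of _ n 0] shift_space_range by (fastforce simp: coded_set_def)

text \<open>By disjointness, the words of increasing length attached to a point of the right-hand side
  extend one another.\<close>

lemma coded_set_eq: "coded_set n = (\<Inter>m. \<Union>\<alpha>\<in>shift_space N A. itinerary_set f V \<alpha> m n)"
proof (intro equalityI subsetI)
  show "x \<in> (\<Inter>m. \<Union>\<alpha>\<in>shift_space N A. itinerary_set f V \<alpha> m n)" if "x \<in> coded_set n" for x
    using that iterate_point by (auto simp: coded_set_def mem_itinerary_set)
next
  fix x assume "x \<in> (\<Inter>m. \<Union>\<alpha>\<in>shift_space N A. itinerary_set f V \<alpha> m n)"
  then have "\<forall>m. \<exists>\<alpha>\<in>shift_space N A. x \<in> itinerary_set f V \<alpha> m n" by blast
  then obtain a where a: "\<And>m. a m \<in> shift_space N A" "\<And>m. x \<in> itinerary_set f V (a m) m n"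
    by metis
  \<comment> \<open>The word \<open>a m\<close> describes the orbit of \<open>x\<close> only up to
    time \<open>m\<close>; the diagonal choice reads each symbol from a word that is long
    enough.\<close>
  define s where "s k = a k k" for k
  have s: "s k = a m k" if "k \<le> m" for k m
    unfolding s_def using that a by (intro symbol_unique) (auto simp: mem_itinerary_set)
  have "s \<in> shift_space N A"
    unfolding shift_space_def
  proof (intro CollectI allI)
    fix k show "1 \<le> s k \<and> s k \<le> N \<and> A (s k) (s (Suc k)) = 1"
      \<comment> \<open>Both symbols of the transition occur in the one admissible word
        \<open>a (Suc k)\<close>.\<close>
      using a(1)[of "Suc k"] s[of k "Suc k"] s[of "Suc k" "Suc k"] by (simp add: shift_space_def)
  qed
  moreover have "x = point n s"
    using a(2) by (auto simp: eq_point_iff[OF \<open>s \<in> shift_space N A\<close>] s_def mem_itinerary_set)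
  ultimately show "x \<in> coded_set n"
    by (simp add: coded_set_def)
qed

lemma compact_itinerary: "\<alpha> \<in> shift_space N A \<Longrightarrow> compact (itinerary_set f V \<alpha> m n)"
  by (rule compact_itinerary_set[of "{1..N}"])
     (use compact_V continuous_V shift_space_range in blast)+

lemma finite_itineraries:
  "S \<subseteq> shift_space N A \<Longrightarrow> finite ((\<lambda>\<alpha>. itinerary_set f V \<alpha> m n) ` S)"
  by (rule finite_itinerary_sets[of _ "{1..N}"]) (use shift_space_range in blast)+

lemma compact_itinerary_Union:
  assumes "S \<subseteq> shift_space N A"
  shows "compact (\<Union>\<alpha>\<in>S. itinerary_set f V \<alpha> m n)"
  by (rule compact_Union[OF finite_itineraries[OF assms]]) (use assms compact_itinerary in blast)

lemma compact_coded_set: "compact (coded_set n)"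
proof -
  let ?K = "\<lambda>m. \<Union>\<alpha>\<in>shift_space N A. itinerary_set f V \<alpha> m n"
  have "compact (?K m)" for m
    by (rule compact_itinerary_Union) simp
  \<comment> \<open>The infinite intersection is known only as a closed set; the factor
    \<open>?K 0\<close> supplies compactness.\<close>
  then have "compact (?K 0 \<inter> (\<Inter>m. ?K m))"
    by (intro compact_Int_closed closed_INT ballI compact_imp_closed)
  moreover have "?K 0 \<inter> (\<Inter>m. ?K m) = coded_set n"
    unfolding coded_set_eq by blast
  ultimately show ?thesis by simp
qed

text \<open>The points of the coded set with a given initial word form the complement, within it,
  of a finite union of compact itinerary sets.\<close>

lemma continuous_map_code:
  "continuous_map (top_of_set (coded_set n)) (shift_topology N A) (code n)"
proof (rule continuous_map_shift_topology)
  show "code n x \<in> shift_space N A" if "x \<in> topspace (top_of_set (coded_set n))" for x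
    using that bij_betwE[OF bij_betw_code] by simp
next
  fix x m assume x: "x \<in> topspace (top_of_set (coded_set n))"
  then obtain \<alpha> where \<alpha>: "\<alpha> \<in> shift_space N A" "x = point n \<alpha>"
    by (auto simp: coded_set_def)
  define S where "S = {\<beta> \<in> shift_space N A. \<exists>k\<le>m. \<beta> k \<noteq> \<alpha> k}"
  define U where "U = coded_set n \<inter> - (\<Union>\<beta>\<in>S. itinerary_set f V \<beta> m n)"
  have "closed (\<Union>\<beta>\<in>S. itinerary_set f V \<beta> m n)"
    by (intro compact_imp_closed compact_itinerary_Union) (auto simp: S_def)
  then have "openin (top_of_set (coded_set n)) U"
    unfolding U_def by (intro openin_open_Int open_Compl)
  moreover have "x \<in> U"
  proof -
    \<comment> \<open>Any word that \<open>x\<close> follows up to time \<open>m\<close> agrees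
      there with its own word, so \<open>x\<close> avoids every removed set.\<close>
    have "\<beta> k = \<alpha> k" if "\<beta> \<in> shift_space N A" "x \<in> itinerary_set f V \<beta> m n" "k \<le> m" for \<beta> k
      using that \<alpha> iterate_point by (intro symbol_unique) (auto simp: mem_itinerary_set)
    then show ?thesis
      using x by (auto simp: U_def S_def)
  qed
  moreover have "code n y k = code n x k" if y: "y \<in> U" and k: "k \<le> m" for y k
  proof -
    obtain \<beta> where \<beta>: "\<beta> \<in> shift_space N A" "y = point n \<beta>"
      using y by (auto simp: U_def coded_set_def)
    then have "y \<in> itinerary_set f V \<beta> m n"
      by (simp add: mem_itinerary_set iterate_point)
    then have "\<beta> \<notin> S"
      using y by (auto simp: U_def)
    then show ?thesis
      using \<alpha> \<beta> k by (auto simp: S_def code_point)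
  qed
  ultimately show "\<exists>U. openin (top_of_set (coded_set n)) U \<and> x \<in> U \<and>
      (\<forall>y\<in>U. \<forall>k\<le>m. code n y k = code n x k)"
    by blast
qed

lemma continuous_map_inv_code:
  "continuous_map (shift_topology N A) (top_of_set (coded_set n)) (inv_into (coded_set n) (code n))"
proof -
  have "homeomorphic_map (top_of_set (coded_set n)) (shift_topology N A) (code n)"
    using bij_betw_code[of n] compact_coded_set[of n]
    by (intro continuous_imp_homeomorphic_map continuous_map_code
        Metric_space.Hausdorff_space_mtopology[OF Metric_space_shift_space])
       (auto simp: bij_betw_def topspace_shift_topology compact_space_subtopology)
  then obtain g where g: "homeomorphic_maps (top_of_set (coded_set n)) (shift_topology N A) (code n) g"
    unfolding homeomorphic_map_maps by blast
  then have "continuous_map (shift_topology N A) (top_of_set (coded_set n)) g"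
    by (simp add: homeomorphic_maps_def)
  \<comment> \<open>The inverse \<open>g\<close> comes from an existence statement; injectivity of
    \<open>code n\<close> identifies it with \<open>inv_into\<close> on the shift space.\<close>
  moreover have "g \<alpha> = inv_into (coded_set n) (code n) \<alpha>"
    if "\<alpha> \<in> topspace (shift_topology N A)" for \<alpha>
  proof -
    have "g \<alpha> \<in> coded_set n" "code n (g \<alpha>) = \<alpha>"
      using g that continuous_map_image_subset_topspace by (fastforce simp: homeomorphic_maps_def)+
    then show ?thesis
      using inv_into_f_eq[of "code n" "coded_set n"] bij_betw_code[of n] by (simp add: bij_betw_def)
  qed
  ultimately show ?thesis
    by (rule continuous_map_eq)
qed

lemma conjugate_coded_set: "conjugate_to_shift f coded_set N A"
  unfolding conjugate_to_shift_def invariant_subsystem_def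
  using map_coded_set bij_betw_code continuous_map_code continuous_map_inv_code code_map by blast

lemma coded_set_nonempty: "coded_set n \<noteq> {}"
proof -
  have "1 \<in> {1..N}" using matrix by (simp add: transition_matrix_def)
  then obtain s where "s \<in> shift_space N A"
    using shift_space_start[OF matrix] by blast
  then show ?thesis by (auto simp: coded_set_def)
qed

end

section \<open>From a conjugacy to the sets V\<close>

text \<open>Splitting by first symbol pulls back clopen cylinders, which gives compact pieces. An
  orbit that visits the pieces named by \<alpha> has code \<alpha>, and bijectivity of the conjugacy
  leaves exactly one such point. For \<open>i\<close> outside \<open>{1..N}\<close> the piece is
  empty.\<close>

lemma itinerary_partition_of_conjugate:
  fixes f :: "nat \<Rightarrow> 'a::metric_space \<Rightarrow> 'a"
  assumes "transition_matrix N A"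
    and "\<And>n. compact (\<Lambda> n)"
    and "conjugate_to_shift f \<Lambda> N A"
  obtains V where "\<And>n i. i \<in> {1..N} \<Longrightarrow> V i n \<noteq> {}"
    and "\<And>n i. compact (V i n)"
    and "\<And>n i j. i \<noteq> j \<Longrightarrow> V i n \<inter> V j n = {}"
    and "\<And>n i. V i n \<subseteq> \<Lambda> n"
    and "\<And>n \<alpha>. \<alpha> \<in> shift_space N A \<Longrightarrow> is_singleton (\<Inter>m. itinerary_set f V \<alpha> m n)"
proof -
  obtain h where inv: "\<And>n. f n ` \<Lambda> n \<subseteq> \<Lambda> (Suc n)"
    and bij: "\<And>n. bij_betw (h n) (\<Lambda> n) (shift_space N A)"
    and cont: "\<And>n. continuous_map (top_of_set (\<Lambda> n)) (shift_topology N A) (h n)"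
    and conj: "\<And>n x. x \<in> \<Lambda> n \<Longrightarrow> h (Suc n) (f n x) = shift_map (h n x)"
    using assms(3) unfolding conjugate_to_shift_def invariant_subsystem_def by metis
  define V where "V i n = {x \<in> \<Lambda> n. h n x 0 = i}" for i n
  show thesis
  proof
    show "V i n \<noteq> {}" if i: "i \<in> {1..N}" for n i
    proof -
      obtain s where "s \<in> shift_space N A" "s 0 = i"
        using shift_space_start[OF assms(1) i] by blast
      then show ?thesis
        using bij_betw_imp_surj_on[OF bij[of n]] by (force simp: V_def)
    qed
    show "compact (V i n)" for n i
    proof -
      have "closedin (top_of_set (\<Lambda> n))
          {x \<in> topspace (top_of_set (\<Lambda> n)). h n x \<in> {s \<in> shift_space N A. s 0 = i}}"
        by (rule closedin_continuous_map_preimage[OF cont closedin_shift_topology_symbol])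
      moreover have "{x \<in> topspace (top_of_set (\<Lambda> n)). h n x \<in> {s \<in> shift_space N A. s 0 = i}} = V i n"
        using bij_betwE[OF bij[of n]] by (auto simp: V_def)
      ultimately show ?thesis
        using closedin_compact[OF assms(2)] by simp
    qed
    show "V i n \<inter> V j n = {}" if "i \<noteq> j" for n i j
      using that by (auto simp: V_def)
    show "V i n \<subseteq> \<Lambda> n" for n i
      by (auto simp: V_def)
    show "is_singleton (\<Inter>m. itinerary_set f V \<alpha> m n)" if "\<alpha> \<in> shift_space N A" for n \<alpha>
    proof -
      have "x \<in> (\<Inter>m. itinerary_set f V \<alpha> m n) \<longleftrightarrow> x \<in> \<Lambda> n \<and> h n x = \<alpha>" for x
      proof -
        \<comment> \<open>Membership in \<open>\<Lambda> n\<close> is part of the condition at time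
          0.\<close>
        have "x \<in> (\<Inter>m. itinerary_set f V \<alpha> m n) \<longleftrightarrow>
            x \<in> \<Lambda> n \<and> (\<forall>k. iterate_from f n k x \<in> V (\<alpha> k) (n + k))"
          unfolding mem_Inter_itinerary_set by (auto simp: V_def dest: spec[of _ 0])
        \<comment> \<open>Invariance keeps the iterates in the sets
          \<open>\<Lambda> (n + k)\<close>, and the first symbol of the k-th iterate is symbol k of
          \<open>h n x\<close>.\<close>
        also have "\<dots> \<longleftrightarrow> x \<in> \<Lambda> n \<and> (\<forall>k. h n x k = \<alpha> k)"
          using coding_iterate_from[of f \<Lambda> h x n _ 0, OF inv conj]
            iterate_from_in_forward_invariant[of f \<Lambda> x n, OF inv]
          by (auto simp: V_def)
        finally show ?thesis by auto
      qed
      moreover have "\<alpha> \<in> h n ` \<Lambda> n" "inj_on (h n) (\<Lambda> n)"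
        using bij[of n] that by (simp_all add: bij_betw_def)
      then obtain y where "y \<in> \<Lambda> n" "h n y = \<alpha>" "\<And>x. x \<in> \<Lambda> n \<Longrightarrow> h n x = \<alpha> \<Longrightarrow> x = y"
        by (auto simp: inj_on_def)
      ultimately have "(\<Inter>m. itinerary_set f V \<alpha> m n) = {y}"
        by blast
      then show ?thesis by (simp add: is_singleton_def)
    qed
  qed
qed

theorem theorem3p2:
  fixes f :: "nat \<Rightarrow> 'a::metric_space \<Rightarrow> 'a"
    and N :: nat
    and A :: "nat \<Rightarrow> nat \<Rightarrow> nat"
  assumes "transition_matrix N A"
  shows
    "(\<exists>V :: nat \<Rightarrow> nat \<Rightarrow> 'a set.
        (\<forall>n. \<forall>i\<in>{1..N}. V i n \<noteq> {} \<and> compact (V i n)) \<and>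
        (\<forall>n. \<forall>i\<in>{1..N}. \<forall>j\<in>{1..N}. i \<noteq> j \<longrightarrow> V i n \<inter> V j n = {}) \<and>
        (\<forall>n. continuous_on (\<Union>k. \<Union>i\<in>{1..N}. V i k) (f n)) \<and>
        (\<forall>n. \<forall>\<alpha>\<in>shift_space N A. is_singleton (\<Inter>m. itinerary_set f V \<alpha> m n)))
     \<longleftrightarrow>
     (\<exists>\<Lambda> :: nat \<Rightarrow> 'a set.
        (\<forall>n. \<Lambda> n \<noteq> {} \<and> compact (\<Lambda> n) \<and> f n ` \<Lambda> n = \<Lambda> (Suc n)) \<and>
        (\<forall>n. continuous_on (\<Union>k. \<Lambda> k) (f n)) \<and>
        conjugate_to_shift f \<Lambda> N A)"
    (is "?a \<longleftrightarrow> ?b")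
proof
  assume ?a
  then obtain V where comp: "\<forall>n. \<forall>i\<in>{1..N}. V i n \<noteq> {} \<and> compact (V i n)"
    and disj: "\<forall>n. \<forall>i\<in>{1..N}. \<forall>j\<in>{1..N}. i \<noteq> j \<longrightarrow> V i n \<inter> V j n = {}"
    and cont: "\<forall>n. continuous_on (\<Union>k. \<Union>i\<in>{1..N}. V i k) (f n)"
    and sing: "\<forall>n. \<forall>\<alpha>\<in>shift_space N A. is_singleton (\<Inter>m. itinerary_set f V \<alpha> m n)"
    by (elim exE conjE) (rule that)
  interpret coded_system f V N A
  proof
    show "i = j" if "i \<in> {1..N}" "j \<in> {1..N}" "x \<in> V i n" "x \<in> V j n" for i j x n
      using disj that by blast
    show "continuous_on (V i n) (f n)" if "i \<in> {1..N}" for i n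
      by (rule continuous_on_subset[OF cont[rule_format]]) (use that in blast)
  qed (use assms comp sing in blast)+
  have "continuous_on (\<Union>k. coded_set k) (f n)" for n
    by (rule continuous_on_subset[OF cont[rule_format]]) (use coded_set_subset in blast)
  then show ?b
    using coded_set_nonempty compact_coded_set map_coded_set conjugate_coded_set by blast
next
  assume ?b
  then obtain \<Lambda> where comp: "\<forall>n. \<Lambda> n \<noteq> {} \<and> compact (\<Lambda> n) \<and> f n ` \<Lambda> n = \<Lambda> (Suc n)"
    and cont: "\<forall>n. continuous_on (\<Union>k. \<Lambda> k) (f n)"
    and conj: "conjugate_to_shift f \<Lambda> N A"
    by (elim exE conjE) (rule that)
  have comp': "compact (\<Lambda> n)" for n
    using comp by blast
  obtain V where V: "\<And>n i. i \<in> {1..N} \<Longrightarrow> V i n \<noteq> {}" "\<And>n i. compact (V i n)"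
      "\<And>n i j. i \<noteq> j \<Longrightarrow> V i n \<inter> V j n = {}" "\<And>n i. V i n \<subseteq> \<Lambda> n"
      "\<And>n \<alpha>. \<alpha> \<in> shift_space N A \<Longrightarrow> is_singleton (\<Inter>m. itinerary_set f V \<alpha> m n)"
    by (rule itinerary_partition_of_conjugate[OF assms comp' conj]) (rule that)
  have "continuous_on (\<Union>k. \<Union>i\<in>{1..N}. V i k) (f n)" for n
    by (rule continuous_on_subset[OF cont[rule_format]]) (use V(4) in blast)
  with V show ?a
    by (intro exI[of _ V]) simp
qed

end
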